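(* Assume $L$ has Gram matrix $G=\begin{pmatrix}\alpha&1\\1&\beta\end{pmatrix}$ with $\alpha,\beta\in\mathcal{O}$ and $1\leq\operatorname{ord}_\mathfrak{p}(\alpha)\leq\min(e,\operatorname{ord}_\mathfrak{p}(\beta))$ (notation in the context). If $\mathfrak{t}_m\geq e+1$, then $\beta_{\mathfrak{p}}^{+}(X;X)=N(\mathfrak{p})^{-\mathfrak{t}_m}$.
   Context: $K$ is a finite extension of $\mathbb{Q}_p$ with ring of integers $\mathcal{O}$, maximal ideal $\mathfrak{p}$, uniformizer $\pi$, normalized valuation $\operatorname{ord}_\mathfrak{p}$ ($\operatorname{ord}_\mathfrak{p}(0)=\infty$), $e=\operatorname{ord}_\mathfrak{p}(2)$, $N(\mathfrak{p})=|\mathcal{O}/\mathfrak{p}|$. $L$ is a lattice in a $2$-dimensional quadratic space over $K$ with basis $\{e_1,e_2\}$ and Gram matrix $G$ as in the claim. $X=L+\nu$ with $\nu=(s_1e_1+s_2e_2)/\pi^{\mathfrak{t}_m}$, $\mathfrak{t}_m\in\mathbb{Z}$, $s_1,s_2\in\mathcal{O}$, at least one a unit. Put $\mathfrak{t}_L=e-\operatorname{ord}_\mathfrak{p}(\alpha)$. For $t\geq\max(\mathfrak{t}_m,\mathfrak{t}_L+1)$, $O^{+}(X,\mathfrak{p}^t)=\{M\in\mathrm{GL}_2(\mathcal{O}/\mathfrak{p}^t): M^TGM\equiv G,\ \det M\equiv1\pmod{\mathfrak{p}^{t+\mathfrak{t}_L}},\ M\binom{s_1}{s_2}\equiv\binom{s_1}{s_2}\pmod{\mathfrak{p}^{\mathfrak{t}_m}}\}$,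 and $\beta_{\mathfrak{p}}^{+}(X;X)=\lim_{t\to\infty}|O^{+}(X,\mathfrak{p}^t)|/N(\mathfrak{p})^t$.
   Formalization: In O^+(X,p^t), M^TGM≡G is read with diagonal entries compared modulo 2p^{t+t_L} (entrywise the claim fails: K=Q_2, α=β=2, t_m=2, s=(1,0) gives 1, not 1/4), and the conditions modulo p^{t+t_L} are required of some lift of M to O. *)

theory Defs
  imports "HOL-Analysis.Analysis" "HOL-Library.Extended"
begin

text \<open>
  A valuation \<^term>\<open>v\<close> is a function to the integers of which only the values at nonzero arguments
  matter; \<open>ordp v\<close> is the same valuation with the value \<open>\<infinity>\<close> at \<open>0\<close>.
\<close>

definition ordp :: "('a::field \<Rightarrow> int) \<Rightarrow> 'a \<Rightarrow> int extended" where
  "ordp v x = (if x = 0 then \<infinity> else Fin (v x))"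

text \<open>\<open>pp v n\<close> is the fractional ideal \<open>\<pp>\<^sup>n\<close>.\<close>

definition pp :: "('a::field \<Rightarrow> int) \<Rightarrow> int \<Rightarrow> 'a set" where
  "pp v n = {x. Fin n \<le> ordp v x}"

definition integers :: "('a::field \<Rightarrow> int) \<Rightarrow> 'a set" where
  "integers v = pp v 0"

definition residue_card :: "('a::field \<Rightarrow> int) \<Rightarrow> nat" where
  "residue_card v =
     card (integers v // {(x, y). x \<in> integers v \<and> y \<in> integers v \<and> x - y \<in> pp v 1})"

text \<open>The topological closure of \<open>\<rat>\<close> in the field, for the topology given by \<^term>\<open>v\<close>.\<close>

definition rat_closure :: "('a::field_char_0 \<Rightarrow> int) \<Rightarrow> 'a set" where
  "rat_closure v = {x. \<forall>n. \<exists>q\<in>\<rat>. x - q \<in> pp v n}"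

text \<open>
  A finite extension of \<open>\<rat>\<^sub>p\<close>, given together with its normalized valuation. The field
  \<open>\<rat>\<^sub>p\<close> is the completion of \<open>\<rat>\<close> at \<open>p\<close>: by \<open>above_p\<close> the valuation restricted to \<open>\<rat>\<close> is
  equivalent to the \<open>p\<close>-adic one, and by \<open>complete\<close> every Cauchy sequence of rationals has a limit,
  so that the closure of \<open>\<rat>\<close> is a copy of \<open>\<rat>\<^sub>p\<close>; \<open>finite_ext\<close> says that the whole field is
  a finite-dimensional vector space over it.
\<close>

locale padic_field =
  fixes p :: nat and v :: "'a::field_char_0 \<Rightarrow> int"
  assumes prime_p: "prime p"
    and val_mult: "x \<noteq> 0 \<Longrightarrow> y \<noteq> 0 \<Longrightarrow> v (x * y) = v x + v y"
    and val_add: "x \<noteq> 0 \<Longrightarrow> y \<noteq> 0 \<Longrightarrow> x + y \<noteq> 0 \<Longrightarrow> min (v x) (v y) \<le> v (x + y)"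
    and normalized: "\<exists>x. x \<noteq> 0 \<and> v x = 1"
    and above_p: "v (of_nat p) > 0"
    and complete: "(\<And>i::nat. f i \<in> \<rat>) \<Longrightarrow> (\<And>n. \<exists>N. \<forall>i\<ge>N. \<forall>j\<ge>N. f i - f j \<in> pp v n) \<Longrightarrow>
       \<exists>x. \<forall>n. \<exists>N. \<forall>i\<ge>N. f i - x \<in> pp v n"
    and finite_ext: "\<exists>B. finite B \<and>
       (\<forall>x. \<exists>c. (\<forall>b\<in>B. c b \<in> rat_closure v) \<and> x = (\<Sum>b\<in>B. c b * b))"

text \<open>
  The coset \<open>X = L + \<nu>\<close> of the lattice \<open>L = \<O> e1 + \<O> e2\<close> in a two-dimensional quadratic
  space, \<open>\<nu> = (s1 e1 + s2 e2) / \<pi>\<^sup>m\<close>; \<open>B\<close> is the symmetric bilinear form of the space and \<open>m\<close> is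
  the integer called \<open>\<tt>\<^sub>m\<close> in the literature.
\<close>

locale binary_lattice_coset =
  padic_field p v + vector_space scale
  for p :: nat and v :: "'a::field_char_0 \<Rightarrow> int"
    and scale :: "'a \<Rightarrow> 'v::ab_group_add \<Rightarrow> 'v" +
  fixes B :: "'v \<Rightarrow> 'v \<Rightarrow> 'a" and e1 e2 :: 'v and \<pi> :: 'a and s1 s2 :: 'a and m :: int
    and L X :: "'v set"
  assumes form_linear: "Vector_Spaces.linear scale (*) (B x)"
    and form_sym: "B x y = B y x"
    and basis: "e1 \<noteq> e2" "independent {e1, e2}" "span {e1, e2} = UNIV"
    and uniformizer: "ordp v \<pi> = 1"
    and s_integral: "s1 \<in> integers v" "s2 \<in> integers v"
    and s_primitive: "ordp v s1 = 0 \<or> ordp v s2 = 0"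
    and lattice: "L = {scale x e1 + scale y e2 | x y. x \<in> integers v \<and> y \<in> integers v}"
    and coset: "X = {l + scale (\<pi> powi (- m)) (scale s1 e1 + scale s2 e2) | l. l \<in> L}"

definition gram :: "('v \<Rightarrow> 'v \<Rightarrow> 'a::field) \<Rightarrow> 'v \<Rightarrow> 'v \<Rightarrow> 'a^2^2" where
  "gram B e1 e2 = vector [vector [B e1 e1, B e1 e2], vector [B e2 e1, B e2 e2]]"

definition tL :: "('a::field_char_0 \<Rightarrow> int) \<Rightarrow> 'a^2^2 \<Rightarrow> int" where
  "tL v G = v 2 - v (G $ 1 $ 1)"

definition int_mats :: "('a::field \<Rightarrow> int) \<Rightarrow> ('a^2^2) set" where
  "int_mats v = {M. \<forall>i j. M $ i $ j \<in> integers v}"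

definition mat_cong :: "('a::field \<Rightarrow> int) \<Rightarrow> int \<Rightarrow> 'a^2^2 \<Rightarrow> 'a^2^2 \<Rightarrow> bool" where
  "mat_cong v n M N \<longleftrightarrow> (\<forall>i j. M $ i $ j - N $ i $ j \<in> pp v n)"

text \<open>
  Congruence of Gram matrices modulo \<open>\<pp>\<^sup>n\<close> in the sense usual for local densities (Siegel,
  Kitaoka): the difference lies in \<open>\<pp>\<^sup>n\<close> times the lattice of even symmetric matrices, that is,
  diagonal entries are compared modulo \<open>2\<pp>\<^sup>n\<close>. Over a dyadic ring this is stronger than
  entrywise congruence.
\<close>

definition gram_cong :: "('a::field_char_0 \<Rightarrow> int) \<Rightarrow> int \<Rightarrow> 'a^2^2 \<Rightarrow> 'a^2^2 \<Rightarrow> bool" where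
  "gram_cong v n S T \<longleftrightarrow>
     mat_cong v n S T \<and> (\<forall>i. (S $ i $ i - T $ i $ i) / 2 \<in> pp v n)"

text \<open>
  \<open>GL\<^sub>2(\<O>/\<pp>\<^sup>t)\<close>: its elements are congruence classes of integral matrices.
\<close>

definition GL2_mod :: "('a::field \<Rightarrow> int) \<Rightarrow> nat \<Rightarrow> ('a^2^2) set set" where
  "GL2_mod v t =
     {M \<in> int_mats v. \<exists>N\<in>int_mats v.
        mat_cong v (int t) (M ** N) (mat 1) \<and> mat_cong v (int t) (N ** M) (mat 1)}
     // {(M, N). M \<in> int_mats v \<and> N \<in> int_mats v \<and> mat_cong v (int t) M N}"

text \<open>
  \<open>O\<^sup>+(X, \<pp>\<^sup>t)\<close>. The modulus \<open>\<pp>\<^bsup>t + tL\<^esup>\<close> is finer than \<open>\<pp>\<^sup>t\<close>, so the conditions are imposed on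
  some integral representative of the class. For the class itself the last condition does not
  depend on the representative once \<open>t \<ge> m\<close>.
\<close>

definition O_plus ::
    "('a::field_char_0 \<Rightarrow> int) \<Rightarrow> 'a^2^2 \<Rightarrow> 'a^2 \<Rightarrow> int \<Rightarrow> nat \<Rightarrow> ('a^2^2) set set" where
  "O_plus v G s m t =
     {C \<in> GL2_mod v t. \<exists>M\<in>C.
        gram_cong v (int t + tL v G) (transpose M ** G ** M) G \<and>
        det M - 1 \<in> pp v (int t + tL v G) \<and>
        (\<forall>i. (M *v s) $ i - s $ i \<in> pp v m)}"

definition density_seq ::
    "('a::field_char_0 \<Rightarrow> int) \<Rightarrow> 'a^2^2 \<Rightarrow> 'a^2 \<Rightarrow> int \<Rightarrow> nat \<Rightarrow> real" where
  "density_seq v G s m t = real (card (O_plus v G s m t)) / real (residue_card v) ^ t"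

text \<open>
  \<open>\<beta>\<^sub>\<pp>\<^sup>+(X; X)\<close>, in terms of the coordinates \<^term>\<open>(G, s, m)\<close> of the coset.
\<close>

definition beta_plus :: "('a::field_char_0 \<Rightarrow> int) \<Rightarrow> 'a^2^2 \<Rightarrow> 'a^2 \<Rightarrow> int \<Rightarrow> real" where
  "beta_plus v G s m = lim (density_seq v G s m)"

end

theory Submission
  imports Defs
begin

text \<open>
  Put \<open>\<delta> = 2 / \<alpha>\<close>, \<open>\<gamma> = \<beta> / \<alpha>\<close>, both integral, and let \<open>\<theta>\<^sup>2 = \<delta> \<theta> - \<gamma>\<close>. The exact proper isometries of \<open>L\<close>
  are the multiplications by elements \<open>a + c \<theta>\<close> of norm \<open>a\<^sup>2 + \<delta> a c + \<gamma> c\<^sup>2 = 1\<close> on the order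
  \<open>\<O>[\<theta>]\<close>, and an isometry modulo \<open>\<pp>\<^bsup>t + tL\<^esup>\<close> agrees modulo \<open>\<pp>\<^sup>t\<close> with such a multiplication,
  the norm being \<open>1\<close> modulo \<open>\<pp>\<^bsup>t + 2 tL\<^esup>\<close>. Stabilizing the coset means that \<open>a = 1 + x + g c\<close>
  with \<open>x \<in> \<pp>\<^sup>m\<close> and \<open>c\<close> in an ideal \<open>J\<close>, for a suitable integral \<open>g\<close>. After division by \<open>\<delta>\<close> the norm
  equation has a unit as its derivative with respect to \<open>c\<close>, so that by Hensel's lemma every
  \<open>x \<in> \<pp>\<^sup>m\<close> determines \<open>c\<close>, and \<open>O\<^sup>+(X, \<pp>\<^sup>t)\<close> is in bijection with \<open>\<pp>\<^sup>m / \<pp>\<^sup>t\<close>.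
\<close>

section \<open>Fractional ideals of a discrete valuation\<close>

context padic_field
begin

lemma pp_iff: "x \<in> pp v n \<longleftrightarrow> x = 0 \<or> n \<le> v x"
  by (auto simp: pp_def ordp_def)

lemma integers_iff: "x \<in> integers v \<longleftrightarrow> x \<in> pp v 0"
  by (simp add: integers_def)

lemma zero_in_pp [simp]: "0 \<in> pp v n"
  by (simp add: pp_iff)

lemma pp_mono: "x \<in> pp v n \<Longrightarrow> k \<le> n \<Longrightarrow> x \<in> pp v k"
  by (auto simp: pp_iff)

lemma v_one [simp]: "v 1 = 0"
  using val_mult[of 1 1] by simp

lemma v_uminus [simp]: "v (- x) = v x"
proof (cases "x = 0")
  case False
  have "v (-1) = 0" using val_mult[of "-1" "-1"] by simp
  then show ?thesis using val_mult[of "-1" x] False by simp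
qed simp

lemma v_inverse: "x \<noteq> 0 \<Longrightarrow> v (inverse x) = - v x"
  using val_mult[of x "inverse x"] by simp

lemma v_divide: "x \<noteq> 0 \<Longrightarrow> y \<noteq> 0 \<Longrightarrow> v (x / y) = v x - v y"
  by (simp add: divide_inverse val_mult v_inverse)

lemma one_in_pp [simp]: "1 \<in> pp v 0"
  by (simp add: pp_iff)

lemma pp_uminus: "x \<in> pp v n \<Longrightarrow> - x \<in> pp v n"
  by (auto simp: pp_iff)

lemma pp_add: "x \<in> pp v n \<Longrightarrow> y \<in> pp v n \<Longrightarrow> x + y \<in> pp v n"
  using val_add[of x y] by (cases "x = 0"; cases "y = 0"; cases "x + y = 0") (auto simp: pp_iff)

lemma pp_diff: "x \<in> pp v n \<Longrightarrow> y \<in> pp v n \<Longrightarrow> x - y \<in> pp v n"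
  using pp_add[of x n "- y"] by (simp add: pp_uminus)

lemma pp_mult: "x \<in> pp v n \<Longrightarrow> y \<in> pp v k \<Longrightarrow> x * y \<in> pp v (n + k)"
  by (cases "x = 0"; cases "y = 0") (auto simp: pp_iff val_mult)

lemma pp_multL: "x \<in> pp v n \<Longrightarrow> y \<in> pp v 0 \<Longrightarrow> x * y \<in> pp v n"
  using pp_mult[of x n y 0] by simp

lemma pp_multR: "x \<in> pp v 0 \<Longrightarrow> y \<in> pp v n \<Longrightarrow> x * y \<in> pp v n"
  using pp_mult[of x 0 y n] by simp

lemma pp_divide: "x \<in> pp v n \<Longrightarrow> y \<noteq> 0 \<Longrightarrow> x / y \<in> pp v (n - v y)"
  by (cases "x = 0") (auto simp: pp_iff v_divide)

lemma pp_divide_unit: "x \<in> pp v n \<Longrightarrow> v y = 0 \<Longrightarrow> x / y \<in> pp v n"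
  by (cases "x = 0"; cases "y = 0") (auto simp: pp_iff v_divide)

lemma pp_cancel: "x * y \<in> pp v n \<Longrightarrow> x \<noteq> 0 \<Longrightarrow> y \<in> pp v (n - v x)"
  using pp_divide[of "x * y" n x] by simp

lemma pp_cong_sym: "x - y \<in> pp v n \<Longrightarrow> y - x \<in> pp v n"
  using pp_uminus[of "x - y" n] by simp

lemma pp_cong_trans: "x - y \<in> pp v n \<Longrightarrow> y - z \<in> pp v n \<Longrightarrow> x - z \<in> pp v n"
  using pp_add[of "x - y" n "y - z"] by simp

text \<open>Applying the ultrametric inequality also to x = (x + y) - y bounds
  \<open>v (x + y)\<close> from above, because y has too large a valuation to attain the
  minimum.\<close>

lemma v_add_strict:
  assumes "x \<noteq> 0" "y \<in> pp v (v x + 1)"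
  shows "x + y \<noteq> 0 \<and> v (x + y) = v x"
proof (cases "y = 0")
  case False
  then have y: "v y \<ge> v x + 1" using assms by (simp add: pp_iff)
  have nz: "x + y \<noteq> 0"
  proof
    assume "x + y = 0"
    then have "y = - x" by (simp add: eq_neg_iff_add_eq_0 add.commute)
    then show False using y by simp
  qed
  have "min (v x) (v y) \<le> v (x + y)" using val_add assms False nz by blast
  moreover have "min (v (x + y)) (v y) \<le> v x"
    using val_add[of "x + y" "- y"] assms False nz by simp
  ultimately show ?thesis using y nz by auto
qed (use assms in simp)

lemma one_plus_unit:
  assumes "x \<in> pp v 1"
  shows "1 + x \<noteq> 0" "v (1 + x) = 0"
  using v_add_strict[of 1 x] assms by auto

lemma obtain_uniformizer:
  obtains \<pi> where "\<pi> \<noteq> 0" "\<And>n. v (\<pi> powi n) = n"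
proof -
  obtain x where x: "x \<noteq> 0" "v x = 1" using normalized by blast
  have nat: "v (x ^ n) = int n" for n
    by (induction n) (use x in \<open>auto simp: val_mult\<close>)
  have "v (x powi n) = n" for n
    by (cases "n \<ge> 0") (use x in \<open>auto simp: power_int_def nat v_inverse power_inverse\<close>)
  then show ?thesis using that x by blast
qed

section \<open>Representatives modulo powers of the prime ideal\<close>

lemma residue_transversal:
  assumes "residue_card v > 0"
  obtains T where "finite T" "card T = residue_card v" "T \<subseteq> pp v 0"
    "\<And>x. x \<in> pp v 0 \<Longrightarrow> \<exists>r\<in>T. x - r \<in> pp v 1"
    "\<And>r r'. r \<in> T \<Longrightarrow> r' \<in> T \<Longrightarrow> r - r' \<in> pp v 1 \<Longrightarrow> r = r'"
proof -
  define E where "E = {(x, y). x \<in> pp v 0 \<and> y \<in> pp v 0 \<and> x - y \<in> pp v 1}"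
  have q: "residue_card v = card (pp v 0 // E)"
    by (simp add: residue_card_def integers_def E_def)
  have E: "equiv (pp v 0) E"
    unfolding E_def
    by (rule equivI) (auto simp: refl_on_def sym_def trans_def intro: pp_cong_sym pp_cong_trans)
  define c where "c C = (SOME x. x \<in> C)" for C :: "'a set"
  have c: "c C \<in> C" if "C \<in> pp v 0 // E" for C
    using in_quotient_imp_non_empty[OF E that] by (auto simp: c_def intro: someI)
  have cC: "C = E `` {c C}" if "C \<in> pp v 0 // E" for C
    using that c[OF that] E by (metis Image_singleton_iff equiv_class_eq quotientE)
  have cin: "c C \<in> pp v 0" if "C \<in> pp v 0 // E" for C
    using c[OF that] in_quotient_imp_subset[OF E that] by blast
  have inj: "inj_on c (pp v 0 // E)"
    by (rule inj_onI) (metis cC)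
  show ?thesis
  proof (rule that[of "c ` (pp v 0 // E)"])
    \<comment> \<open>A positive cardinality excludes the infinite case, where \<open>card\<close>
      is 0.\<close>
    show "finite (c ` (pp v 0 // E))" using assms q card_gt_0_iff by auto
    show "card (c ` (pp v 0 // E)) = residue_card v" using card_image[OF inj] q by simp
    show "c ` (pp v 0 // E) \<subseteq> pp v 0" using cin by blast
    show "\<exists>r\<in>c ` (pp v 0 // E). x - r \<in> pp v 1" if "x \<in> pp v 0" for x
    proof -
      have C: "E `` {x} \<in> pp v 0 // E" using that by (rule quotientI)
      from c[OF C] have "x - c (E `` {x}) \<in> pp v 1" by (auto simp: E_def)
      then show ?thesis using C by blast
    qed
    show "r = r'" if rr: "r \<in> c ` (pp v 0 // E)" "r' \<in> c ` (pp v 0 // E)" "r - r' \<in> pp v 1" for r r'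
    proof -
      obtain C D where C: "C \<in> pp v 0 // E" "r = c C" and D: "D \<in> pp v 0 // E" "r' = c D"
        using rr(1,2) by (elim imageE) metis
      have "(r, r') \<in> E" using rr C D cin by (simp add: E_def)
      then have "C = D" using cC[OF C(1)] cC[OF D(1)] C D equiv_class_eq[OF E] by metis
      then show ?thesis using C D by simp
    qed
  qed
qed

text \<open>Digit expansion: a representative at level n is refined by adding w s, where w has
  valuation m + n and the digit s runs through representatives of the residue field. Each level
  multiplies the count by \<open>residue_card v\<close>.\<close>

lemma ideal_transversal:
  assumes "residue_card v > 0"
  shows "\<exists>R. finite R \<and> card R = residue_card v ^ n \<and> R \<subseteq> pp v m \<and>
    (\<forall>x\<in>pp v m. \<exists>r\<in>R. x - r \<in> pp v (m + int n)) \<and>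
    (\<forall>r\<in>R. \<forall>r'\<in>R. r - r' \<in> pp v (m + int n) \<longrightarrow> r = r')"
proof (induction n)
  case 0
  show ?case by (rule exI[of _ "{0}"]) auto
next
  case (Suc n)
  then obtain R where R: "finite R" "card R = residue_card v ^ n" "R \<subseteq> pp v m"
    "\<And>x. x \<in> pp v m \<Longrightarrow> \<exists>r\<in>R. x - r \<in> pp v (m + int n)"
    "\<And>r r'. r \<in> R \<Longrightarrow> r' \<in> R \<Longrightarrow> r - r' \<in> pp v (m + int n) \<Longrightarrow> r = r'"
    by blast
  obtain T where T: "finite T" "card T = residue_card v" "T \<subseteq> pp v 0"
    "\<And>x. x \<in> pp v 0 \<Longrightarrow> \<exists>r\<in>T. x - r \<in> pp v 1"
    "\<And>r r'. r \<in> T \<Longrightarrow> r' \<in> T \<Longrightarrow> r - r' \<in> pp v 1 \<Longrightarrow> r = r'"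
    using residue_transversal[OF assms] by metis
  obtain \<pi> where \<pi>: "\<pi> \<noteq> 0" "\<And>n. v (\<pi> powi n) = n" using obtain_uniformizer by blast
  define w where "w = \<pi> powi (m + int n)"
  have w: "w \<noteq> 0" "v w = m + int n" using \<pi> by (auto simp: w_def)
  then have wpp: "w \<in> pp v (m + int n)" by (simp add: pp_iff)
  have wT: "w * s \<in> pp v (m + int n)" if "s \<in> T" for s
    using that T(3) wpp pp_multL by blast
  define g where "g = (\<lambda>(r, s). r + w * s)"
  have eq: "r = r' \<and> s = s'"
    if "r \<in> R" "r' \<in> R" "s \<in> T" "s' \<in> T" "g (r, s) - g (r', s') \<in> pp v (m + int n + 1)" for r r' s s'
  proof -
    \<comment> \<open>At the coarser level the digit terms vanish, which forces r = r'; cancelling w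
      then compares the digits modulo \<open>pp v 1\<close>.\<close>
    have "g (r, s) - g (r', s') \<in> pp v (m + int n)" using that pp_mono by fastforce
    from pp_diff[OF this pp_diff[OF wT[OF that(3)] wT[OF that(4)]]] have r: "r = r'" using R(5) that by (simp add: g_def)
    have "w * (s - s') \<in> pp v (m + int n + 1)" using that r by (simp add: g_def algebra_simps)
    from pp_cancel[OF this w(1)] show ?thesis using r T(5) that w by simp
  qed
  have inj: "inj_on g (R \<times> T)"
    by (rule inj_onI) (use eq in fastforce)
  show ?case
  proof (intro exI[of _ "g ` (R \<times> T)"] conjI ballI impI)
    show "finite (g ` (R \<times> T))" using R T by simp
    show "card (g ` (R \<times> T)) = residue_card v ^ Suc n"
      using R T by (simp add: card_image[OF inj] card_cartesian_product)
    show "g ` (R \<times> T) \<subseteq> pp v m"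
    proof
      fix x assume "x \<in> g ` (R \<times> T)"
      then obtain r s where rs: "r \<in> R" "s \<in> T" "x = r + w * s" by (auto simp: g_def)
      have "w * s \<in> pp v m" using wT[OF rs(2)] by (rule pp_mono) simp
      then show "x \<in> pp v m" using rs R(3) pp_add by blast
    qed
    show "\<exists>r\<in>g ` (R \<times> T). x - r \<in> pp v (m + int (Suc n))" if x: "x \<in> pp v m" for x
    proof -
      obtain r where r: "r \<in> R" "x - r \<in> pp v (m + int n)" using R(4) x by blast
      then have "(x - r) / w \<in> pp v 0" using pp_divide[OF r(2) w(1)] w by simp
      then obtain s where s: "s \<in> T" "(x - r) / w - s \<in> pp v 1" using T(4) by blast
      have "w * ((x - r) / w - s) \<in> pp v (m + int n + 1)" by (rule pp_mult[OF wpp s(2)])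
      moreover have "w * ((x - r) / w - s) = x - g (r, s)"
        using w by (simp add: g_def field_simps)
      ultimately have "x - g (r, s) \<in> pp v (m + int (Suc n))" by (simp add: add.commute add.left_commute)
      then show ?thesis using r s by blast
    qed
    show "x = y" if "x \<in> g ` (R \<times> T)" "y \<in> g ` (R \<times> T)" "x - y \<in> pp v (m + int (Suc n))" for x y
    proof -
      from that(1,2) obtain r s r' s' where "r \<in> R" "s \<in> T" "x = g (r, s)"
        "r' \<in> R" "s' \<in> T" "y = g (r', s')" by auto
      moreover have "x - y \<in> pp v (m + int n + 1)" using that(3) by (simp add: algebra_simps)
      ultimately show ?thesis using eq[of r r' s s'] by simp
    qed
  qed
qed

end

section \<open>Isometries modulo a power of the prime\<close>

text \<open>The parameter \<open>\<gamma>\<close> stands for \<open>\<beta> / \<alpha>\<close>.\<close>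

locale even_binary_form = padic_field p v
  for p :: nat and v :: "'a::field_char_0 \<Rightarrow> int" +
  fixes \<alpha> \<gamma> :: 'a
  assumes alpha_nz: "\<alpha> \<noteq> 0" and v_alpha: "1 \<le> v \<alpha>" "v \<alpha> \<le> v 2"
    and gamma_pp: "\<gamma> \<in> pp v 0"
begin

definition \<delta> :: 'a where "\<delta> = 2 / \<alpha>"
definition h :: int where "h = v 2 - v \<alpha>"

definition G :: "'a^2^2" where "G = vector [vector [\<alpha>, 1], vector [1, \<alpha> * \<gamma>]]"

text \<open>The norm of a + c \<theta>. Multiplied by \<alpha> it is the value of the quadratic form
  at a e1 + c e2, so e1 \<mapsto> 1, e2 \<mapsto> \<theta> identifies the lattice with the order,
  with \<alpha> times the norm as its form.\<close>

definition nrm :: "'a \<Rightarrow> 'a \<Rightarrow> 'a" where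
  "nrm a c = a\<^sup>2 + \<delta> * a * c + \<gamma> * c\<^sup>2"

lemma two_eq: "2 = \<alpha> * \<delta>"
  using alpha_nz by (simp add: \<delta>_def)

lemma alpha_nrm: "\<alpha> * nrm a c = \<alpha> * a\<^sup>2 + 2 * a * c + \<alpha> * \<gamma> * c\<^sup>2"
  using alpha_nz by (simp add: nrm_def \<delta>_def distrib_left)

lemma half_delta: "\<delta> * (\<alpha> * x / 2) = x"
  using alpha_nz by (simp add: \<delta>_def)

lemma delta_nz: "\<delta> \<noteq> 0"
  using alpha_nz by (simp add: \<delta>_def)

lemma v_delta: "v \<delta> = h"
  using alpha_nz by (simp add: \<delta>_def h_def v_divide)

lemma h_nonneg: "0 \<le> h"
  using v_alpha by (simp add: h_def)

lemma delta_pp: "\<delta> \<in> pp v h" "\<delta> \<in> pp v 0"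
  using v_delta h_nonneg by (auto simp: pp_iff)

lemma alpha_pp: "\<alpha> \<in> pp v 1" "\<alpha> \<in> pp v 0"
  using v_alpha by (auto simp: pp_iff)

lemma tL_G: "tL v G = h"
  by (simp add: tL_def G_def h_def)

lemmas pp_intros = pp_add pp_diff pp_uminus pp_multL pp_multR

text \<open>The columns are u = a + c \<theta> and w = b + d \<theta>. The diagonal conditions give
  norms close to 1 and \<gamma>. The other two conditions bring w times the conjugate of u close to
  \<theta>, and multiplying by u brings w close to u \<theta>.\<close>

lemma near_isometry:
  assumes int: "a \<in> pp v 0" "b \<in> pp v 0" "c \<in> pp v 0" "d \<in> pp v 0"
    and t: "v \<alpha> < t"
    and D1: "(\<alpha> * a\<^sup>2 + 2 * a * c + \<alpha> * \<gamma> * c\<^sup>2 - \<alpha>) / 2 \<in> pp v (t + h)"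
    and D2: "(\<alpha> * b\<^sup>2 + 2 * b * d + \<alpha> * \<gamma> * d\<^sup>2 - \<alpha> * \<gamma>) / 2 \<in> pp v (t + h)"
    and D3: "\<alpha> * a * b + a * d + b * c + \<alpha> * \<gamma> * c * d - 1 \<in> pp v (t + h)"
    and D4: "a * d - b * c - 1 \<in> pp v (t + h)"
  shows "nrm a c - 1 \<in> pp v (t + 2 * h)" "b + \<gamma> * c \<in> pp v t" "d - a - \<delta> * c \<in> pp v t"
proof -
  \<comment> \<open>\<open>X + D \<theta>\<close> is the product of \<open>b + d \<theta>\<close> with the conjugate of \<open>a + c \<theta>\<close>.\<close>
  define D where "D = a * d - b * c"
  define X where "X = a * b + \<delta> * b * c + \<gamma> * c * d"
  have eq1: "\<delta> * ((\<alpha> * a\<^sup>2 + 2 * a * c + \<alpha> * \<gamma> * c\<^sup>2 - \<alpha>) / 2) = nrm a c - 1"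
    unfolding alpha_nrm[symmetric] using half_delta[of "nrm a c - 1"] by (simp add: right_diff_distrib)
  have eq2: "\<delta> * ((\<alpha> * b\<^sup>2 + 2 * b * d + \<alpha> * \<gamma> * d\<^sup>2 - \<alpha> * \<gamma>) / 2) = nrm b d - \<gamma>"
    unfolding alpha_nrm[symmetric] using half_delta[of "nrm b d - \<gamma>"]
    by (simp add: right_diff_distrib)
  have sum: "h + (t + h) = t + 2 * h" by simp
  show f1: "nrm a c - 1 \<in> pp v (t + 2 * h)"
    using pp_mult[OF delta_pp(1) D1] unfolding eq1 sum .
  have f2: "nrm b d - \<gamma> \<in> pp v (t + 2 * h)"
    using pp_mult[OF delta_pp(1) D2] unfolding eq2 sum .
  have f1': "nrm a c - 1 \<in> pp v (t + h)" and f2': "nrm b d - \<gamma> \<in> pp v (t + h)"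
    using f1 f2 h_nonneg by (auto elim: pp_mono)
  have f1'': "nrm a c - 1 \<in> pp v t" and D4': "D - 1 \<in> pp v t"
    using f1' D4 h_nonneg by (auto simp: D_def elim: pp_mono)
  have D0: "D \<in> pp v 0" unfolding D_def using int by (intro pp_intros)
  have nbd: "nrm b d \<in> pp v 0"
    unfolding nrm_def power2_eq_square using int delta_pp gamma_pp by (intro pp_intros)
  have "\<alpha> * X = (\<alpha> * a * b + a * d + b * c + \<alpha> * \<gamma> * c * d - 1) - (a * d - b * c - 1) + (\<alpha> * \<delta> - 2) * b * c"
    by (simp add: X_def algebra_simps)
  also have "\<dots> = (\<alpha> * a * b + a * d + b * c + \<alpha> * \<gamma> * c * d - 1) - (a * d - b * c - 1)"
    using two_eq by simp
  finally have "\<alpha> * X \<in> pp v (t + h)" using pp_diff[OF D3 D4] by simp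
  \<comment> \<open>A first, crude bound. The strict inequality \<open>v \<alpha> < t\<close> makes
    X smaller than \<delta> D, so that \<delta> D + X has valuation exactly h and can be cancelled
    below.\<close>
  from pp_cancel[OF this alpha_nz] have "X \<in> pp v (h + 1)"
    by (rule pp_mono) (use t in simp)
  have "D - 1 \<in> pp v 1"
    using D4' by (rule pp_mono) (use t v_alpha in simp)
  then have D: "D \<noteq> 0" "v D = 0" using one_plus_unit[of "D - 1"] by auto
  have vD: "\<delta> * D \<noteq> 0" "v (\<delta> * D) = h" using D delta_nz v_delta by (auto simp: val_mult)
  have XD: "\<delta> * D + X \<noteq> 0" "v (\<delta> * D + X) = h"
    using v_add_strict[of "\<delta> * D" X] \<open>X \<in> pp v (h + 1)\<close> vD by auto
  \<comment> \<open>Multiplicativity of the norm: the left side is the norm of X + D \<theta> minus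
    \<gamma> times the square of D. Cancelling \<delta> D + X costs h and improves the bound on X to
    \<open>pp v t\<close>.\<close>
  have "(\<delta> * D + X) * X = (nrm a c - 1) * nrm b d + (nrm b d - \<gamma>) - \<gamma> * ((D - 1) * (D + 1))"
    by (simp add: nrm_def X_def D_def algebra_simps power2_eq_square)
  also have "\<dots> \<in> pp v (t + h)"
    by (rule pp_diff[OF pp_add[OF pp_multL[OF f1' nbd] f2']
          pp_multR[OF gamma_pp pp_multL[OF D4[folded D_def] pp_add[OF D0 one_in_pp]]]])
  finally have X: "X \<in> pp v t" using pp_cancel[OF _ XD(1)] XD(2) by force
  \<comment> \<open>Both remaining identities compare coefficients in (a + c \<theta>) (X + D
    \<theta>) = \<open>nrm a c\<close> (b + d \<theta>).\<close>
  have "b + \<gamma> * c = a * X - \<gamma> * c * (D - 1) - b * (nrm a c - 1)"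
    by (simp add: nrm_def X_def D_def algebra_simps power2_eq_square)
  also have "\<dots> \<in> pp v t"
    by (intro pp_diff pp_multR[OF _ X] pp_multR[OF _ D4'] pp_multR[OF _ f1''] pp_multR int gamma_pp)
  finally show "b + \<gamma> * c \<in> pp v t" .
  have "d - a - \<delta> * c = a * (D - 1) + c * X + \<delta> * c * (D - 1) - d * (nrm a c - 1)"
    by (simp add: nrm_def X_def D_def algebra_simps power2_eq_square)
  also have "\<dots> \<in> pp v t"
    by (intro pp_diff pp_add pp_multR[OF _ X] pp_multR[OF _ D4'] pp_multR[OF _ f1''] pp_multR int delta_pp)
  finally show "d - a - \<delta> * c \<in> pp v t" .
qed

section \<open>Two by two matrices and their congruence classes\<close>

definition mat2 :: "'a \<Rightarrow> 'a \<Rightarrow> 'a \<Rightarrow> 'a \<Rightarrow> 'a^2^2" where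
  "mat2 a b c d = vector [vector [a, b], vector [c, d]]"

lemma mat2_nth [simp]:
  "mat2 a b c d $ 1 $ 1 = a" "mat2 a b c d $ 1 $ 2 = b"
  "mat2 a b c d $ 2 $ 1 = c" "mat2 a b c d $ 2 $ 2 = d"
  by (simp_all add: mat2_def)

lemma mat2_cases: obtains a b c d where "M = mat2 a b c d"
proof
  show "M = mat2 (M $ 1 $ 1) (M $ 1 $ 2) (M $ 2 $ 1) (M $ 2 $ 2)"
    by (simp add: vec_eq_iff forall_2)
qed

lemma int_mats_mat2:
  "mat2 a b c d \<in> int_mats v \<longleftrightarrow> a \<in> pp v 0 \<and> b \<in> pp v 0 \<and> c \<in> pp v 0 \<and> d \<in> pp v 0"
  by (auto simp: int_mats_def forall_2 integers_iff)

lemma mat_cong_mat2: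
  "mat_cong v n (mat2 a b c d) (mat2 a' b' c' d') \<longleftrightarrow>
     a - a' \<in> pp v n \<and> b - b' \<in> pp v n \<and> c - c' \<in> pp v n \<and> d - d' \<in> pp v n"
  by (auto simp: mat_cong_def forall_2)

lemma gram_mat2:
  "transpose (mat2 a b c d) ** G ** mat2 a b c d =
     mat2 (\<alpha> * a\<^sup>2 + 2 * a * c + \<alpha> * \<gamma> * c\<^sup>2) (\<alpha> * a * b + a * d + b * c + \<alpha> * \<gamma> * c * d)
       (\<alpha> * a * b + a * d + b * c + \<alpha> * \<gamma> * c * d) (\<alpha> * b\<^sup>2 + 2 * b * d + \<alpha> * \<gamma> * d\<^sup>2)"
  by (simp add: vec_eq_iff forall_2 matrix_matrix_mult_def transpose_def sum_2 G_def
      algebra_simps power2_eq_square)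

lemma G_mat2: "G = mat2 \<alpha> 1 1 (\<alpha> * \<gamma>)"
  by (simp add: G_def mat2_def)

lemma det_mat2: "det (mat2 a b c d) = a * d - b * c"
  by (simp add: det_2)

lemma gram_cong_mat2:
  "gram_cong v n (mat2 a b c d) (mat2 a' b' c' d') \<longleftrightarrow>
     mat_cong v n (mat2 a b c d) (mat2 a' b' c' d') \<and> (a - a') / 2 \<in> pp v n \<and> (d - d') / 2 \<in> pp v n"
  by (simp add: gram_cong_def forall_2)

text \<open>M is multiplication by a + c \<theta> in the basis 1, \<theta>: its determinant is the
  norm, and it scales the form by the norm. The norm is needed to precision t + 2 h because halving
  a diagonal difference, a multiple of \<alpha>, amounts to dividing by \<delta>, which costs
  h.\<close>

lemma mult_matrix_isometry:
  assumes int: "a \<in> pp v 0" "c \<in> pp v 0"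
    and f: "nrm a c - 1 \<in> pp v (t + 2 * h)"
  defines "M \<equiv> mat2 a (- \<gamma> * c) c (a + \<delta> * c)"
  shows "gram_cong v (t + h) (transpose M ** G ** M) G" "det M - 1 \<in> pp v (t + h)"
proof -
  have f': "nrm a c - 1 \<in> pp v (t + h)" using f by (rule pp_mono) (use h_nonneg in simp)
  have fd: "(nrm a c - 1) / \<delta> \<in> pp v (t + h)"
    using pp_divide[OF f delta_nz] by (simp add: v_delta add.commute)
  have eq: "transpose M ** G ** M =
      mat2 (\<alpha> * nrm a c) (nrm a c) (nrm a c) (\<alpha> * \<gamma> * nrm a c)"
  proof -
    \<comment> \<open>Carrying along the vanishing factor \<alpha> \<delta> - 2 turns the claims
      into polynomial identities in independent variables.\<close>
    have "\<alpha> * a * (- \<gamma> * c) + a * (a + \<delta> * c) + (- \<gamma> * c) * c + \<alpha> * \<gamma> * c * (a + \<delta> * c) =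
        nrm a c + (\<alpha> * \<delta> - 2) * (\<gamma> * c\<^sup>2)"
      by (simp add: nrm_def algebra_simps power2_eq_square)
    moreover have "\<alpha> * (- \<gamma> * c)\<^sup>2 + 2 * (- \<gamma> * c) * (a + \<delta> * c) + \<alpha> * \<gamma> * (a + \<delta> * c)\<^sup>2 =
        \<alpha> * \<gamma> * nrm a c + (\<alpha> * \<delta> - 2) * (\<gamma> * c * (a + \<delta> * c))"
      by (simp add: nrm_def algebra_simps power2_eq_square)
    moreover have "\<alpha> * \<delta> - 2 = 0" using two_eq by simp
    ultimately show ?thesis
      unfolding M_def gram_mat2 alpha_nrm[symmetric] by (simp only: mult_zero_left add_0_right)
  qed
  have h1: "(\<alpha> * nrm a c - \<alpha>) / 2 = (nrm a c - 1) / \<delta>"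
    using alpha_nz by (simp add: \<delta>_def algebra_simps)
  have h2: "(\<alpha> * \<gamma> * nrm a c - \<alpha> * \<gamma>) / 2 = \<gamma> * ((nrm a c - 1) / \<delta>)"
    using alpha_nz by (simp add: \<delta>_def algebra_simps)
  have 1: "\<alpha> * nrm a c - \<alpha> = \<alpha> * (nrm a c - 1)" and 2: "\<alpha> * \<gamma> * nrm a c - \<alpha> * \<gamma> = \<alpha> * (\<gamma> * (nrm a c - 1))"
    by (simp_all add: algebra_simps)
  show "gram_cong v (t + h) (transpose M ** G ** M) G"
    unfolding eq unfolding G_mat2 gram_cong_mat2 mat_cong_mat2 h1 h2 unfolding 1 2
    using f' fd alpha_pp gamma_pp by (intro conjI pp_multR)
  have "det M - 1 = nrm a c - 1"
    by (simp add: M_def det_mat2 nrm_def algebra_simps power2_eq_square)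
  then show "det M - 1 \<in> pp v (t + h)" using f' by simp
qed

definition mrel :: "nat \<Rightarrow> (('a^2^2) \<times> ('a^2^2)) set" where
  "mrel t = {(M, N). M \<in> int_mats v \<and> N \<in> int_mats v \<and> mat_cong v (int t) M N}"

lemma equiv_mrel: "equiv (int_mats v) (mrel t)"
proof (rule equivI)
  show "mrel t \<subseteq> int_mats v \<times> int_mats v" "refl_on (int_mats v) (mrel t)"
    by (auto simp: mrel_def refl_on_def mat_cong_def)
  show "sym (mrel t)"
    by (auto simp: mrel_def sym_def mat_cong_def intro: pp_cong_sym)
  show "trans (mrel t)"
    unfolding trans_def mrel_def mat_cong_def
    by simp (meson pp_cong_trans)
qed

text \<open>A class is the class of each of its members, so the member that satisfies the finer
  conditions can serve as its representative.\<close>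

lemma O_plusE:
  assumes "C \<in> O_plus v G s m t"
  obtains M where "M \<in> int_mats v" "C = mrel t `` {M}"
    "gram_cong v (int t + h) (transpose M ** G ** M) G"
    "det M - 1 \<in> pp v (int t + h)" "\<And>i. (M *v s) $ i - s $ i \<in> pp v m"
proof -
  from assms obtain M where C: "C \<in> GL2_mod v t" "M \<in> C" and
    M: "gram_cong v (int t + h) (transpose M ** G ** M) G"
    "det M - 1 \<in> pp v (int t + h)" "\<And>i. (M *v s) $ i - s $ i \<in> pp v m"
    by (auto simp: O_plus_def tL_G)
  from C(1) obtain M0 where M0: "M0 \<in> int_mats v" "C = mrel t `` {M0}"
    unfolding GL2_mod_def mrel_def[symmetric] by (auto elim!: quotientE)
  with C(2) have "(M0, M) \<in> mrel t" by simp
  then have "C = mrel t `` {M}" using equiv_class_eq[OF equiv_mrel] M0 by metis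
  moreover have "M \<in> int_mats v" using \<open>(M0, M) \<in> mrel t\<close> by (simp add: mrel_def)
  ultimately show ?thesis using that M by blast
qed

lemma O_plusI:
  assumes M: "M \<in> int_mats v"
    "gram_cong v (int t + h) (transpose M ** G ** M) G"
    "det M - 1 \<in> pp v (int t + h)" "\<And>i. (M *v s) $ i - s $ i \<in> pp v m"
  shows "mrel t `` {M} \<in> O_plus v G s m t"
proof -
  obtain a b c d where abcd: "M = mat2 a b c d" by (rule mat2_cases)
  have int: "a \<in> pp v 0" "b \<in> pp v 0" "c \<in> pp v 0" "d \<in> pp v 0"
    using M(1) abcd int_mats_mat2 by auto
  \<comment> \<open>The adjugate is an inverse modulo \<open>pp v t\<close>, since the determinant
    is congruent to 1.\<close>
  define N where "N = mat2 d (- b) (- c) a"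
  have N: "N \<in> int_mats v" using int by (simp add: N_def int_mats_mat2 pp_uminus)
  have det: "a * d - b * c - 1 \<in> pp v (int t)"
    using M(3) unfolding abcd det_mat2 by (rule pp_mono) (use h_nonneg in simp)
  have prod: "M ** N = mat2 (a * d - b * c) 0 0 (a * d - b * c)"
      "N ** M = mat2 (a * d - b * c) 0 0 (a * d - b * c)"
    by (simp_all add: abcd N_def vec_eq_iff forall_2 matrix_matrix_mult_def sum_2 algebra_simps)
  have one: "mat 1 = mat2 1 0 0 1" by (simp add: vec_eq_iff forall_2 mat_def)
  have "mat_cong v (int t) (M ** N) (mat 1) \<and> mat_cong v (int t) (N ** M) (mat 1)"
    using det by (simp add: prod one mat_cong_mat2)
  then have "mrel t `` {M} \<in> GL2_mod v t"
    unfolding GL2_mod_def mrel_def[symmetric] using M(1) N by (blast intro: quotientI)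
  moreover have "M \<in> mrel t `` {M}" using M(1) by (simp add: mrel_def mat_cong_def)
  ultimately show ?thesis using M by (auto simp: O_plus_def tL_G)
qed

end

section \<open>The stabilizer of the coset\<close>

text \<open>
  By \<open>stab\<close>, \<open>(y + c \<theta>) (s1 + s2 \<theta>)\<close> lies in \<open>\<pp>\<^sup>m \<O>[\<theta>]\<close> if and only if \<open>y - g c \<in> \<pp>\<^sup>m\<close>
  and \<open>c \<in> J\<close>; \<open>nrm g 1\<close> is the norm of \<open>g + \<theta>\<close>.
\<close>

locale stabilizer_congruence = even_binary_form p v \<alpha> \<gamma>
  for p :: nat and v :: "'a::field_char_0 \<Rightarrow> int" and \<alpha> \<gamma> +
  fixes s1 s2 g :: 'a and J :: "'a set" and m :: int
  assumes s_pp: "s1 \<in> pp v 0" "s2 \<in> pp v 0"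
    and g_pp: "g \<in> pp v 0" and m_gt: "v 2 < m"
    and J_add: "x \<in> J \<Longrightarrow> y \<in> J \<Longrightarrow> x + y \<in> J"
    and J_mult: "x \<in> J \<Longrightarrow> y \<in> pp v 0 \<Longrightarrow> x * y \<in> J"
    and J_sup: "x \<in> pp v m \<Longrightarrow> x \<in> J"
    and J_sub: "x \<in> J \<Longrightarrow> x \<in> pp v 0"
    and J_nrm: "x \<in> J \<Longrightarrow> x * nrm g 1 \<in> pp v m"
    and stab: "y \<in> pp v 0 \<Longrightarrow> c \<in> pp v 0 \<Longrightarrow>
      (y * s1 - \<gamma> * c * s2 \<in> pp v m \<and> y * s2 + c * (s1 + \<delta> * s2) \<in> pp v m) \<longleftrightarrow>
      (y - g * c \<in> pp v m \<and> c \<in> J)"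
begin

section \<open>Hensel's lemma for the norm equation divided by \<delta>\<close>

lemma m_pos: "0 < m" "v \<alpha> < m"
  using m_gt v_alpha by auto

lemma J_zero: "0 \<in> J"
  using J_sup by simp

lemma J_diff: "x \<in> J \<Longrightarrow> y \<in> J \<Longrightarrow> x - y \<in> J"
  using J_add[of x "- y"] J_mult[of y "- 1"] by (simp add: pp_uminus)

text \<open>The norm of 1 + x + g c + c \<theta>, minus 1 and divided by \<delta>. As 2 / \<delta> =
  \<alpha>, the linear coefficients are integral; the remaining divisions by \<delta> apply to x and
  to c \<open>nrm g 1\<close>, which lie in \<open>pp v m\<close>.\<close>

definition \<Phi> :: "'a \<Rightarrow> 'a \<Rightarrow> 'a" where
  "\<Phi> x c = c * ((1 + \<alpha> * g) * (1 + x)) + \<alpha> * x + c * (c * nrm g 1 / \<delta>) + x * (x / \<delta>)"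

lemma nrm_eq_Phi: "nrm (1 + x + g * c) c - 1 = \<delta> * \<Phi> x c"
proof -
  have "\<delta> * \<Phi> x c = \<delta> * c * (1 + x) + (\<alpha> * \<delta>) * g * c * (1 + x) + (\<alpha> * \<delta>) * x + c * c * nrm g 1 + x * x"
    using delta_nz by (simp add: \<Phi>_def field_simps)
  also have "\<dots> = nrm (1 + x + g * c) c - 1"
    unfolding two_eq[symmetric] by (simp add: nrm_def algebra_simps power2_eq_square)
  finally show ?thesis ..
qed

text \<open>Here \<open>m > v 2\<close> enters: m exceeds the valuation of \<delta>. Hence the
  quadratic terms of \<open>\<Phi>\<close> do not affect its slope in c modulo the prime.\<close>

lemma div_delta_pp: "x \<in> pp v m \<Longrightarrow> x / \<delta> \<in> pp v 1"
  using pp_mono[OF pp_divide[of x m \<delta>], of 1] delta_nz m_gt v_alpha by (simp add: v_delta h_def)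

lemma Phi_slope_unit:
  assumes "x \<in> pp v m"
  shows "(1 + \<alpha> * g) * (1 + x) \<noteq> 0" "v ((1 + \<alpha> * g) * (1 + x)) = 0"
proof -
  have "x \<in> pp v 1" using assms by (rule pp_mono) (use m_pos in simp)
  note x = one_plus_unit[OF this]
  note g = one_plus_unit[OF pp_multL[OF alpha_pp(1) g_pp]]
  show "(1 + \<alpha> * g) * (1 + x) \<noteq> 0" "v ((1 + \<alpha> * g) * (1 + x)) = 0"
    using x g by (auto simp: val_mult)
qed

text \<open>The difference of the two values of \<open>\<Phi>\<close> is U (c - c') + (x - x') W
  with W integral; the difference quotient U is a unit because its quadratic part lies in
  \<open>pp v 1\<close>.\<close>

lemma Phi_unique:
  assumes x: "x \<in> pp v m" "x' \<in> pp v m" "x - x' \<in> pp v t"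
    and c: "c \<in> J" "c' \<in> J" and Phi: "\<Phi> x c \<in> pp v t" "\<Phi> x' c' \<in> pp v t"
  shows "c - c' \<in> pp v t"
proof -
  define U where "U = (1 + \<alpha> * g) * (1 + x) + (c + c') * nrm g 1 / \<delta>"
  define W where "W = (1 + \<alpha> * g) * c' + \<alpha> + (x + x') / \<delta>"
  have "(c + c') * nrm g 1 / \<delta> \<in> pp v 1"
    using div_delta_pp J_nrm J_add c by simp
  then have U: "U \<noteq> 0" "v U = 0"
    using v_add_strict[of "(1 + \<alpha> * g) * (1 + x)"] Phi_slope_unit[OF x(1)] by (auto simp: U_def)
  have "(x + x') / \<delta> \<in> pp v 0"
    using pp_mono[OF div_delta_pp[OF pp_add[OF x(1,2)]], of 0] by simp
  then have W: "W \<in> pp v 0"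
    unfolding W_def using alpha_pp g_pp J_sub[OF c(2)] by (intro pp_intros one_in_pp)
  have "U * (c - c') = \<Phi> x c - \<Phi> x' c' - (x - x') * W"
    using delta_nz by (simp add: U_def W_def \<Phi>_def field_simps)
  also have "\<dots> \<in> pp v t" by (rule pp_diff[OF pp_diff[OF Phi] pp_multL[OF x(3) W]])
  finally show ?thesis using pp_cancel[OF _ U(1)] U(2) by force
qed

text \<open>Newton's iteration from c = 0, gaining one power of the prime at each step and staying
  in J.\<close>

lemma Phi_solvable:
  assumes x: "x \<in> pp v m"
  shows "\<exists>c\<in>J. \<Phi> x c \<in> pp v (int n)"
proof (induction n)
  case 0
  have "x / \<delta> \<in> pp v 0" using pp_mono[OF div_delta_pp[OF x], of 0] by simp
  moreover have "x \<in> pp v 0" using x by (rule pp_mono) (use m_pos in simp)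
  ultimately have "\<Phi> x 0 \<in> pp v 0"
    unfolding \<Phi>_def using alpha_pp by (auto intro!: pp_add pp_multL simp del: times_divide_eq_right)
  then show ?case using J_zero by (intro bexI[of _ 0]) auto
next
  case (Suc n)
  then obtain c where c: "c \<in> J" "\<Phi> x c \<in> pp v (int n)" by blast
  define U where "U = (1 + \<alpha> * g) * (1 + x)"
  have U: "U \<noteq> 0" "v U = 0" using Phi_slope_unit[OF x] by (auto simp: U_def)
  \<comment> \<open>The constant slope U, the linear coefficient, replaces the full derivative; the
    two agree modulo the prime, so one power is still gained.\<close>
  define c' where "c' = c - \<Phi> x c / U"
  have x0: "x \<in> pp v 0" using x by (rule pp_mono) (use m_pos in simp)
  have xd: "x / \<delta> \<in> pp v 0" using pp_mono[OF div_delta_pp[OF x], of 0] by simp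
  have cd: "c * nrm g 1 / \<delta> \<in> pp v 0"
    using pp_mono[OF div_delta_pp[OF J_nrm[OF c(1)]], of 0] by simp
  \<comment> \<open>Every term is an integral multiple of c or of x, and J is an ideal containing
    \<open>pp v m\<close>.\<close>
  have "\<Phi> x c \<in> J"
    unfolding \<Phi>_def using c(1) x x0 xd cd alpha_pp g_pp
    by (intro J_add J_mult[of c] J_mult[OF J_sup, of x] J_sup[OF pp_multR] pp_intros one_in_pp)
  moreover have "1 / U \<in> pp v 0" using pp_divide_unit[OF one_in_pp U(2)] .
  ultimately have "\<Phi> x c / U \<in> J" using J_mult[of "\<Phi> x c" "1 / U"] by simp
  then have c': "c' \<in> J" unfolding c'_def by (intro J_diff c)
  have "\<Phi> x c' = \<Phi> x c + (c' - c) * U + (c' - c) * ((c + c') * nrm g 1 / \<delta>)"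
    using delta_nz by (simp add: U_def \<Phi>_def field_simps)
  also have "\<dots> = (c' - c) * ((c + c') * nrm g 1 / \<delta>)"
    using U by (simp add: c'_def)
  also have "\<dots> \<in> pp v (int n + 1)"
  proof (rule pp_mult)
    show "c' - c \<in> pp v (int n)"
      using pp_uminus[OF pp_divide_unit[OF c(2) U(2)]] by (simp add: c'_def)
    show "(c + c') * nrm g 1 / \<delta> \<in> pp v 1"
      using div_delta_pp J_nrm J_add c c' by simp
  qed
  finally show ?case using c' by (intro bexI[of _ c']) (auto simp: add.commute)
qed

section \<open>Parametrization of the stabilizer and its cardinality\<close>

definition point :: "'a \<Rightarrow> 'a \<Rightarrow> 'a^2^2" where
  "point x c = mat2 (1 + x + g * c) (- \<gamma> * c) c (1 + x + g * c + \<delta> * c)"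

lemma point_int: "x \<in> pp v m \<Longrightarrow> c \<in> J \<Longrightarrow> point x c \<in> int_mats v"
  unfolding point_def int_mats_mat2
  using pp_mono[of x m 0] m_pos J_sub[of c] gamma_pp g_pp delta_pp
  by (intro conjI pp_intros one_in_pp pp_uminus) auto

text \<open>\<open>point x c\<close> is multiplication by 1 + x + g c + c \<theta>. Fixing s modulo
  \<open>pp v m\<close> means that x + g c + c \<theta> maps s1 + s2 \<theta> into that multiple of
  the order, which is \<open>stab\<close> with y = x + g c.\<close>

lemma point_in_O_plus:
  assumes x: "x \<in> pp v m" and c: "c \<in> J" and Phi: "\<Phi> x c \<in> pp v (int t + h)"
  shows "mrel t `` {point x c} \<in> O_plus v G (vector [s1, s2]) m t"
proof -
  have a: "1 + x + g * c \<in> pp v 0" and c0: "c \<in> pp v 0"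
    using point_int[OF x c] by (auto simp: point_def int_mats_mat2)
  have xg: "x + g * c \<in> pp v 0" using pp_diff[OF a one_in_pp] by simp
  have f: "nrm (1 + x + g * c) c - 1 \<in> pp v (int t + 2 * h)"
    using pp_mult[OF delta_pp(1) Phi] unfolding nrm_eq_Phi by (simp add: algebra_simps)
  have "(x + g * c) * s1 - \<gamma> * c * s2 \<in> pp v m" "(x + g * c) * s2 + c * (s1 + \<delta> * s2) \<in> pp v m"
    using stab[OF xg c0] x c by auto
  then have "(point x c *v vector [s1, s2]) $ i - (vector [s1, s2] :: 'a^2) $ i \<in> pp v m" for i
    using exhaust_2[of i]
    by (auto simp: point_def matrix_vector_mult_def sum_2 algebra_simps)
  then show ?thesis
    using O_plusI[OF point_int[OF x c]] mult_matrix_isometry[OF a c0 f] by (auto simp: point_def)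
qed

text \<open>By \<open>near_isometry\<close> a representative is congruent to multiplication by a + c
  \<theta>, and x is read off from a = 1 + x + g c. Dividing the norm congruence by \<delta> lowers
  its precision from t + 2 h to t + h.\<close>

lemma O_plus_point:
  assumes C: "C \<in> O_plus v G (vector [s1, s2]) m t" and t: "m \<le> int t"
  obtains x c where "x \<in> pp v m" "c \<in> J" "\<Phi> x c \<in> pp v (int t + h)" "C = mrel t `` {point x c}"
proof -
  obtain M where M: "M \<in> int_mats v" "C = mrel t `` {M}"
    "gram_cong v (int t + h) (transpose M ** G ** M) G"
    "det M - 1 \<in> pp v (int t + h)"
    "\<And>i. (M *v vector [s1, s2]) $ i - (vector [s1, s2] :: 'a^2) $ i \<in> pp v m"
    using O_plusE[OF C] by metis
  obtain a b c d where abcd: "M = mat2 a b c d" by (rule mat2_cases)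
  have int: "a \<in> pp v 0" "b \<in> pp v 0" "c \<in> pp v 0" "d \<in> pp v 0"
    using M(1) abcd int_mats_mat2 by auto
  have "v \<alpha> < int t" using m_pos t by simp
  note near = near_isometry[OF int this]
  have near: "nrm a c - 1 \<in> pp v (int t + 2 * h)" "b + \<gamma> * c \<in> pp v (int t)"
      "d - a - \<delta> * c \<in> pp v (int t)"
    using M(3,4) unfolding abcd gram_mat2 unfolding G_mat2 gram_cong_mat2 mat_cong_mat2 det_mat2
    by (auto intro: near)
  define x where "x = a - 1 - g * c"
  have bc: "b + \<gamma> * c \<in> pp v m" "d - a - \<delta> * c \<in> pp v m"
    using near t by (auto elim: pp_mono)
  have "a * s1 + b * s2 - s1 \<in> pp v m" "c * s1 + d * s2 - s2 \<in> pp v m"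
    using M(5)[of 1] M(5)[of 2] by (auto simp: abcd matrix_vector_mult_def sum_2)
  \<comment> \<open>As m \<le> t, replacing the second column by that of the multiplication matrix
    preserves the coset condition and brings it into the form of \<open>stab\<close>.\<close>
  then have "a * s1 + b * s2 - s1 - (b + \<gamma> * c) * s2 \<in> pp v m"
    "c * s1 + d * s2 - s2 - (d - a - \<delta> * c) * s2 \<in> pp v m"
    using bc s_pp by (auto intro!: pp_diff pp_multL)
  then have "(a - 1) * s1 - \<gamma> * c * s2 \<in> pp v m" "(a - 1) * s2 + c * (s1 + \<delta> * s2) \<in> pp v m"
    by (simp_all add: algebra_simps)
  then have x: "x \<in> pp v m" and c: "c \<in> J"
    using stab[of "a - 1" c] int by (auto simp: x_def pp_diff)
  have a: "1 + x + g * c = a" by (simp add: x_def)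
  have "\<Phi> x c \<in> pp v (int t + 2 * h - v \<delta>)"
    using near(1) pp_cancel[OF _ delta_nz] unfolding nrm_eq_Phi[of x c, unfolded a] by blast
  then have "\<Phi> x c \<in> pp v (int t + h)" by (simp add: v_delta add.commute)
  moreover have "(M, point x c) \<in> mrel t"
    using near M(1) point_int[OF x c]
    unfolding mrel_def abcd point_def a by (simp add: mat_cong_mat2 algebra_simps)
  then have "C = mrel t `` {point x c}"
    using M(2) equiv_class_eq[OF equiv_mrel] by metis
  ultimately show ?thesis using that x c by blast
qed

text \<open>Each representative x of \<open>pp v m\<close> modulo \<open>pp v t\<close> gets a root
  \<open>k x\<close> to precision t + h, as membership requires; precision t then suffices for
  \<open>Phi_unique\<close> to show that every class is reached.\<close>

lemma card_O_plus:
  assumes q: "residue_card v > 0" and t: "m \<le> int t"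
  shows "card (O_plus v G (vector [s1, s2]) m t) = residue_card v ^ (t - nat m)"
proof -
  have mt: "m + int (t - nat m) = int t" using t m_pos by simp
  obtain R where R: "card R = residue_card v ^ (t - nat m)" "R \<subseteq> pp v m"
    "\<And>x. x \<in> pp v m \<Longrightarrow> \<exists>r\<in>R. x - r \<in> pp v (int t)"
    "\<And>r r'. r \<in> R \<Longrightarrow> r' \<in> R \<Longrightarrow> r - r' \<in> pp v (int t) \<Longrightarrow> r = r'"
    using ideal_transversal[OF q, of "t - nat m" m] unfolding mt by blast
  have th: "int (t + nat h) = int t + h" using h_nonneg by simp
  obtain k where k: "\<And>x. x \<in> R \<Longrightarrow> k x \<in> J" "\<And>x. x \<in> R \<Longrightarrow> \<Phi> x (k x) \<in> pp v (int t + h)"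
    using Phi_solvable[of _ "t + nat h"] R(2) unfolding th by (metis subsetD)
  have low: "y \<in> pp v (int t)" if "y \<in> pp v (int t + h)" for y
    using that by (rule pp_mono) (use h_nonneg in simp)
  define F where "F x = mrel t `` {point x (k x)}" for x
  have "bij_betw F R (O_plus v G (vector [s1, s2]) m t)"
  proof (rule bij_betw_imageI)
    show "inj_on F R"
    proof (rule inj_onI)
      fix x y assume xy: "x \<in> R" "y \<in> R" "F x = F y"
      have "point y (k y) \<in> F y"
        using point_int[of y "k y"] xy R(2) k by (auto simp: F_def mrel_def mat_cong_def)
      then have "mat_cong v (int t) (point x (k x)) (point y (k y))"
        using xy(3) by (auto simp: F_def mrel_def)
      then have "(1 + x + g * k x) - (1 + y + g * k y) \<in> pp v (int t)" "k x - k y \<in> pp v (int t)"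
        by (auto simp: point_def mat_cong_mat2)
      \<comment> \<open>The entries in the first column recover x modulo
        \<open>pp v t\<close>.\<close>
      then have "(1 + x + g * k x) - (1 + y + g * k y) - g * (k x - k y) \<in> pp v (int t)"
        by (rule pp_diff[OF _ pp_multR[OF g_pp]])
      then show "x = y" using R(4)[OF xy(1,2)] by (simp add: algebra_simps)
    qed
    show "F ` R = O_plus v G (vector [s1, s2]) m t"
    proof (intro equalityI subsetI)
      fix C assume "C \<in> F ` R"
      then show "C \<in> O_plus v G (vector [s1, s2]) m t"
        using point_in_O_plus R(2) k by (auto simp: F_def)
    next
      fix C assume "C \<in> O_plus v G (vector [s1, s2]) m t"
      then obtain x c where x: "x \<in> pp v m" "c \<in> J" "\<Phi> x c \<in> pp v (int t + h)"
        "C = mrel t `` {point x c}" using O_plus_point t by blast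
      obtain r where r: "r \<in> R" "x - r \<in> pp v (int t)" using R(3) x by blast
      then have rm: "r \<in> pp v m" using R(2) by blast
      have c: "c - k r \<in> pp v (int t)"
        using Phi_unique[OF x(1) rm r(2) x(2) k(1)[OF r(1)] low[OF x(3)] low[OF k(2)[OF r(1)]]] .
      have a: "(1 + x + g * c) - (1 + r + g * k r) \<in> pp v (int t)"
        using pp_add[OF r(2) pp_multR[OF g_pp c]] by (simp add: algebra_simps)
      have b: "- \<gamma> * c - - \<gamma> * k r \<in> pp v (int t)"
        using pp_multR[OF pp_uminus[OF gamma_pp] c] by (simp add: algebra_simps)
      have d: "(1 + x + g * c + \<delta> * c) - (1 + r + g * k r + \<delta> * k r) \<in> pp v (int t)"
        using pp_add[OF a pp_multR[OF delta_pp(2) c]] by (simp add: algebra_simps)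
      have "(point x c, point r (k r)) \<in> mrel t"
        using point_int[OF x(1,2)] point_int[OF rm k(1)[OF r(1)]] a b c d
        unfolding mrel_def point_def by (simp add: mat_cong_mat2)
      then have "C = F r" using x(4) equiv_class_eq[OF equiv_mrel] by (auto simp: F_def)
      then show "C \<in> F ` R" using r by blast
    qed
  qed
  then show ?thesis using bij_betw_same_card R(1) by fastforce
qed

end

section \<open>The ideal J for a primitive vector, and the density\<close>

context even_binary_form
begin

text \<open>If s2 is a unit, the second coordinate fixes y modulo \<open>pp v m\<close> in terms of
  c, and the first becomes the condition defining J. Otherwise s1 + s2 \<theta> has unit norm, is
  invertible in the order, and y and c must both lie in \<open>pp v m\<close>.\<close>

lemma stabilizer_congruence_exists:
  assumes s: "s1 \<in> pp v 0" "s2 \<in> pp v 0" and prim: "ordp v s1 = 0 \<or> ordp v s2 = 0"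
    and m: "v 2 < m"
  shows "\<exists>g J. stabilizer_congruence p v \<alpha> \<gamma> s1 s2 g J m"
proof (cases "ordp v s2 = 0")
  case True
  then have u: "s2 \<noteq> 0" "v s2 = 0" by (auto simp: ordp_def zero_extended_def split: if_splits)
  \<comment> \<open>This g solves y s2 + c (s1 + \<delta> s2) = 0 as y = g c; equivalently, g +
    \<theta> is the conjugate of s1 + s2 \<theta> divided by - s2.\<close>
  define g where "g = - (s1 / s2) - \<delta>"
  define J where "J = {x \<in> pp v 0. x * nrm g 1 \<in> pp v m}"
  have g: "g \<in> pp v 0"
    unfolding g_def using pp_divide_unit[OF s(1) u(2)] delta_pp by (intro pp_intros)
  have m0: "0 \<le> m" using m v_alpha by simp
  have n: "nrm g 1 \<in> pp v 0"
    unfolding nrm_def power2_eq_square using g delta_pp gamma_pp by (intro pp_intros one_in_pp)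
  have eq1: "y * s2 + c * (s1 + \<delta> * s2) = (y - g * c) * s2" for y c
    using u by (simp add: g_def field_simps)
  have eq2: "y * s1 - \<gamma> * c * s2 = (y - g * c) * s1 - (c * nrm g 1) * s2" for y c
  proof -
    have s1: "s1 = - (g + \<delta>) * s2" using u by (simp add: g_def)
    show ?thesis unfolding s1 by (simp add: nrm_def algebra_simps power2_eq_square)
  qed
  have cancel: "x * s2 \<in> pp v m \<longleftrightarrow> x \<in> pp v m" for x
    using pp_divide_unit[of "x * s2" m s2] u pp_multL[OF _ s(2)] by auto
  have "stabilizer_congruence p v \<alpha> \<gamma> s1 s2 g J m"
  proof
    fix y c assume y: "y \<in> pp v 0" and c: "c \<in> pp v 0"
    show "(y * s1 - \<gamma> * c * s2 \<in> pp v m \<and> y * s2 + c * (s1 + \<delta> * s2) \<in> pp v m) \<longleftrightarrow>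
      (y - g * c \<in> pp v m \<and> c \<in> J)"
    proof (cases "y - g * c \<in> pp v m")
      case True
      then have z: "(y - g * c) * s1 \<in> pp v m" using s by (intro pp_multL)
      have "(y - g * c) * s1 - (c * nrm g 1) * s2 \<in> pp v m \<longleftrightarrow> (c * nrm g 1) * s2 \<in> pp v m"
        using pp_diff[OF z, of "(y - g * c) * s1 - (c * nrm g 1) * s2"]
          pp_diff[OF z, of "(c * nrm g 1) * s2"] by auto
      then show ?thesis using True c unfolding eq1 eq2 cancel by (simp add: J_def)
    qed (simp add: eq1 cancel)
    show "x * y \<in> J" if "x \<in> J" "y \<in> pp v 0" for x y
      using that pp_multL[of x 0 y] pp_multL[of "x * nrm g 1" m y] by (simp add: J_def mult_ac)
  qed (use s g m n m0 in \<open>auto simp: J_def distrib_right pp_add pp_multL elim: pp_mono\<close>)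
  then show ?thesis by blast
next
  case False
  then have u: "s1 \<noteq> 0" "v s1 = 0"
    using prim by (auto simp: ordp_def zero_extended_def split: if_splits)
  have s2: "s2 \<in> pp v 1"
    using False s(2) by (auto simp: ordp_def zero_extended_def pp_iff split: if_splits)
  have m0: "0 \<le> m" using m v_alpha by simp
  have "stabilizer_congruence p v \<alpha> \<gamma> s1 s2 0 (pp v m) m"
  proof
    fix y c assume y: "y \<in> pp v 0" and c: "c \<in> pp v 0"
    show "(y * s1 - \<gamma> * c * s2 \<in> pp v m \<and> y * s2 + c * (s1 + \<delta> * s2) \<in> pp v m) \<longleftrightarrow>
      (y - 0 * c \<in> pp v m \<and> c \<in> pp v m)" (is "?A \<and> ?B \<longleftrightarrow> _")
    proof safe
      assume A: ?A and B: ?B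
      \<comment> \<open>E is the norm of s1 + s2 \<theta>, a unit since s2 is not one. Multiplying
        by the conjugate isolates c E.\<close>
      define E where "E = s1 * s1 + (\<delta> * s1 + \<gamma> * s2) * s2"
      have "(\<delta> * s1 + \<gamma> * s2) * s2 \<in> pp v 1"
        using s2 s delta_pp gamma_pp by (intro pp_multR pp_intros)
      then have E: "E \<noteq> 0" "v E = 0"
        unfolding E_def using v_add_strict[of "s1 * s1"] u by (auto simp: val_mult)
      have "c * E = (y * s2 + c * (s1 + \<delta> * s2)) * s1 - (y * s1 - \<gamma> * c * s2) * s2"
        by (simp add: E_def algebra_simps)
      then have "c * E \<in> pp v m" using A B s by (simp add: pp_diff pp_multL)
      then show c: "c \<in> pp v m" using pp_divide_unit[of "c * E" m E] E by simp
      have "y * s1 = (y * s1 - \<gamma> * c * s2) + c * (\<gamma> * s2)" by simp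
      also have "\<dots> \<in> pp v m" by (rule pp_add[OF A pp_multL[OF c pp_multR[OF gamma_pp s(2)]]])
      finally show "y - 0 * c \<in> pp v m" using pp_divide_unit[of "y * s1" m s1] u by simp
    next
      assume "y - 0 * c \<in> pp v m" and c: "c \<in> pp v m"
      then have y: "y \<in> pp v m" by simp
      show ?A by (rule pp_diff[OF pp_multL[OF y s(1)] pp_multL[OF pp_multR[OF gamma_pp c] s(2)]])
      show ?B by (rule pp_add[OF pp_multL[OF y s(2)] pp_multL[OF c pp_add[OF s(1) pp_multR[OF delta_pp(2) s(2)]]]])
    qed
  qed (use s m m0 gamma_pp in \<open>auto simp: pp_add pp_multL nrm_def elim: pp_mono\<close>)
  then show ?thesis by blast
qed

lemma density_seq_eq:
  assumes s: "s1 \<in> pp v 0" "s2 \<in> pp v 0" and prim: "ordp v s1 = 0 \<or> ordp v s2 = 0"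
    and m: "v 2 < m" and t: "m \<le> int t"
  shows "density_seq v G (vector [s1, s2]) m t = real (residue_card v) powi (- m)"
proof (cases "residue_card v = 0")
  \<comment> \<open>The junk case of an infinite residue field: both sides are \<open>0\<close>.\<close>
  case True
  then show ?thesis using m v_alpha t by (simp add: density_seq_def power_0_left power_int_0_left_if)
next
  case False
  obtain g J where "stabilizer_congruence p v \<alpha> \<gamma> s1 s2 g J m"
    using stabilizer_congruence_exists[OF s prim m] by blast
  then interpret stabilizer_congruence p v \<alpha> \<gamma> s1 s2 g J m .
  have "real (residue_card v) ^ (t - nat m) / real (residue_card v) ^ t =
      real (residue_card v) powi (- m)"
    using False t m_pos by (simp add: power_diff power_int_minus power_int_def field_simps)
  then show ?thesis using card_O_plus[OF _ t] False by (simp add: density_seq_def)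
qed

end

theorem theorem3p6:
  fixes p :: nat and v :: "'a::field_char_0 \<Rightarrow> int"
    and scale :: "'a \<Rightarrow> 'v::ab_group_add \<Rightarrow> 'v" and B :: "'v \<Rightarrow> 'v \<Rightarrow> 'a"
    and e1 e2 :: 'v and \<pi> \<alpha> \<beta> s1 s2 :: 'a and \<tt>\<^sub>m :: int and L X :: "'v set"
  assumes "binary_lattice_coset p v scale B e1 e2 \<pi> s1 s2 \<tt>\<^sub>m L X"
    and "gram B e1 e2 = vector [vector [\<alpha>, 1], vector [1, \<beta>]]"
    and "\<alpha> \<in> integers v" and "\<beta> \<in> integers v"
    and "1 \<le> ordp v \<alpha>" and "ordp v \<alpha> \<le> min (ordp v 2) (ordp v \<beta>)"
    and "Fin \<tt>\<^sub>m \<ge> ordp v 2 + 1"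
  shows "convergent (density_seq v (gram B e1 e2) (vector [s1, s2]) \<tt>\<^sub>m) \<and>
    beta_plus v (gram B e1 e2) (vector [s1, s2]) \<tt>\<^sub>m = real (residue_card v) powi (- \<tt>\<^sub>m)"
proof -
  interpret binary_lattice_coset p v scale B e1 e2 \<pi> s1 s2 \<tt>\<^sub>m L X by fact
  have two: "v 2 < \<tt>\<^sub>m"
    using assms(7) by (simp add: ordp_def one_extended_def)
  \<comment> \<open>Since 2 is nonzero, its order is finite, which excludes \<alpha> = 0.\<close>
  have alpha: "\<alpha> \<noteq> 0" "v \<alpha> \<le> v 2"
    using assms(6) by (auto simp: ordp_def split: if_splits)
  moreover have "1 \<le> v \<alpha>" using assms(5) alpha by (simp add: ordp_def one_extended_def)
  moreover have "\<beta> \<in> pp v (v \<alpha>)" using assms(6) alpha by (simp add: pp_def ordp_def)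
  then have "\<beta> / \<alpha> \<in> pp v 0" using pp_divide alpha by fastforce
  ultimately interpret even_binary_form p v \<alpha> "\<beta> / \<alpha>" by unfold_locales
  define s :: "'a^2" where "s = vector [s1, s2]"
  have "density_seq v G s \<tt>\<^sub>m t = real (residue_card v) powi (- \<tt>\<^sub>m)" if "nat \<tt>\<^sub>m \<le> t" for t
    unfolding s_def
    by (rule density_seq_eq)
      (use s_integral s_primitive two that in \<open>auto simp: integers_iff\<close>)
  then have "density_seq v G s \<tt>\<^sub>m \<longlonglongrightarrow> real (residue_card v) powi (- \<tt>\<^sub>m)"
    by (intro tendsto_eventually eventually_sequentiallyI)
  then show ?thesis
    using assms(2) by (auto simp: G_def s_def alpha beta_plus_def convergent_def intro: limI)
qed

end
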